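(* Let $k$ be a positive integer and let $G$ be a connected (finite or infinite) graph which is $k$-locatable. Then $G^{1/m}$ is locatable for every integer $m\geq 2k+2$.
   Context: Graphs are simple and undirected and may be infinite; $d(\cdot,\cdot)$ denotes graph distance. The $k$-probe Robber Locating game on a graph $G$ (known to both players): a robber occupies a vertex of $G$, initially arbitrary and unknown to the cop. Cop and robber alternate turns, the cop first. At her turn the cop chooses a list $u_1,\ldots,u_k$ of vertices (all specified before any answer is received) and is then told the distances $d(v,u_1),\ldots,d(v,u_k)$, where $v$ is the robber's current location. If from this and all previous information she can deduce $v$, she wins. At his turn the robber may stay where he is or move to an adjacent vertex. $G$ is $k$-locatable if the cop has a deterministic strategy (each list of probes may depend on previous answers) which wins after finitely many turns against every possible starting vertex and sequence of moves of the robber. $G$ is locatable if it is $1$-locatable. For a positive integer $m$, $G^{1/m}$ is the graph obtained from $G$ by replacing each edge by a path of length $m$ (with $m-1$ new internal vertices for each edge). *)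

theory Defs
  imports "Graph_Theory.Shortest_Path" "Graph_Theory.Pair_Digraph" "Graph_Theory.Digraph_Component"
begin

text \<open>
  A simple undirected graph, possibly infinite, is a pair digraph whose arc relation is symmetric
  and irreflexive: the locale \<open>pair_bidirected_digraph\<close>, which has no finiteness assumption.
\<close>

definition gdist :: "'a pair_pre_digraph \<Rightarrow> 'a \<Rightarrow> 'a \<Rightarrow> ereal" where
  "gdist G u v = wf_digraph.\<mu> (with_proj G) (\<lambda>_. 1) u v"


subsection \<open>The robber locating game\<close>

text \<open>
  Turn \<open>t\<close> consists of the cop's probe, made while the robber is at \<open>r t\<close>, followed by the
  robber's move to \<open>r (Suc t)\<close>. A robber play is an infinite sequence; only the part up to the
  cop's win matters.
\<close>

definition robber_play :: "'a pair_pre_digraph \<Rightarrow> (nat \<Rightarrow> 'a) \<Rightarrow> bool" where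
  "robber_play G r \<longleftrightarrow>
     (\<forall>t. r t \<in> pverts G) \<and> (\<forall>t. r (Suc t) = r t \<or> (r t, r (Suc t)) \<in> parcs G)"

text \<open>
  A strategy maps the list of all answers received so far (oldest first, one list of distances
  per past turn) to the next list of probes. Since the strategy is deterministic, the earlier
  probes are determined by the earlier answers.
\<close>

type_synonym 'a strategy = "ereal list list \<Rightarrow> 'a list"

definition probe_strategy :: "nat \<Rightarrow> 'a pair_pre_digraph \<Rightarrow> 'a strategy \<Rightarrow> bool" where
  "probe_strategy k G \<sigma> \<longleftrightarrow> (\<forall>h. length (\<sigma> h) = k \<and> set (\<sigma> h) \<subseteq> pverts G)"

text \<open>\<open>answers G \<sigma> r t\<close> lists the answers to the first \<open>t\<close> probe lists, those of turns \<open>0, \<dots>, t - 1\<close>.\<close>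

primrec answers ::
  "'a pair_pre_digraph \<Rightarrow> 'a strategy \<Rightarrow> (nat \<Rightarrow> 'a) \<Rightarrow> nat \<Rightarrow> ereal list list" where
  "answers G \<sigma> r 0 = []"
| "answers G \<sigma> r (Suc t) =
     answers G \<sigma> r t @ [map (\<lambda>u. gdist G (r t) u) (\<sigma> (answers G \<sigma> r t))]"

text \<open>
  After the answer of turn \<open>t\<close> the cop can deduce the robber's current location iff all robber
  plays consistent with everything she has been told have the same position at time \<open>t\<close>.
\<close>

definition located_at ::
  "'a pair_pre_digraph \<Rightarrow> 'a strategy \<Rightarrow> (nat \<Rightarrow> 'a) \<Rightarrow> nat \<Rightarrow> bool" where
  "located_at G \<sigma> r t \<longleftrightarrow>
     (\<forall>r'. robber_play G r' \<and> answers G \<sigma> r' (Suc t) = answers G \<sigma> r (Suc t) \<longrightarrow> r' t = r t)"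

text \<open>The number of turns needed may depend on the robber's play; no uniform bound is required.\<close>

definition k_locatable :: "nat \<Rightarrow> 'a pair_pre_digraph \<Rightarrow> bool" where
  "k_locatable k G \<longleftrightarrow>
     (\<exists>\<sigma>. probe_strategy k G \<sigma> \<and> (\<forall>r. robber_play G r \<longrightarrow> (\<exists>t. located_at G \<sigma> r t)))"

definition locatable :: "'a pair_pre_digraph \<Rightarrow> bool" where
  "locatable G \<longleftrightarrow> k_locatable 1 G"


subsection \<open>Subdivision of every edge into a path of length \<open>m\<close>\<close>

text \<open>
  \<open>subdiv_point m u v i\<close> is the vertex at distance \<open>i\<close> from \<open>u\<close> on the path of length \<open>m\<close>
  replacing the edge \<open>uv\<close>. An inner vertex is labelled by its distances to both ends of the edge,
  as an unordered pair, so that traversing the edge as \<open>uv\<close> or as \<open>vu\<close> yields the same path.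
\<close>

datatype 'a subdiv_vertex = Branch 'a | Inner "('a \<times> nat) set"

definition subdiv_point :: "nat \<Rightarrow> 'a \<Rightarrow> 'a \<Rightarrow> nat \<Rightarrow> 'a subdiv_vertex" where
  "subdiv_point m u v i =
     (if i = 0 then Branch u else if i = m then Branch v else Inner {(u, i), (v, m - i)})"

text \<open>
  The graph \<open>G\<^sup>1\<^sup>/\<^sup>m\<close>, for \<open>m \<ge> 1\<close>. Both orientations of each new edge are present because
  both orientations of each edge of \<open>G\<close> are.
\<close>

definition subdivide_edges :: "nat \<Rightarrow> 'a pair_pre_digraph \<Rightarrow> 'a subdiv_vertex pair_pre_digraph" where
  "subdivide_edges m G =
     \<lparr> pverts = Branch ` pverts G \<union>
         {subdiv_point m u v i | u v i. (u, v) \<in> parcs G \<and> 0 < i \<and> i < m},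
       parcs = {(subdiv_point m u v i, subdiv_point m u v (Suc i)) | u v i.
         (u, v) \<in> parcs G \<and> i < m} \<rparr>"

lemma subdiv_point_rev: "m > 0 \<Longrightarrow> i \<le> m \<Longrightarrow> subdiv_point m v u (m - i) = subdiv_point m u v i"
  by (auto simp: subdiv_point_def)

lemma subdivide_edges_bidirected:
  assumes "pair_bidirected_digraph G" and "m > 0"
  shows "pair_bidirected_digraph (subdivide_edges m G)"
proof -
  interpret pair_bidirected_digraph G by fact
  have sym: "(v, u) \<in> parcs G" if "(u, v) \<in> parcs G" for u v
    using that pair_sym_arcs by (auto simp: symmetric_def elim: symE)
  have neq: "u \<noteq> v" if "(u, v) \<in> parcs G" for u v
    using that pair_no_loops by fastforce
  have pt: "subdiv_point m u v i \<in> pverts (subdivide_edges m G)"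
    if "(u, v) \<in> parcs G" "i \<le> m" for u v i
  proof (cases "i = 0 \<or> i = m")
    case True
    with that in_arcsD1 in_arcsD2 show ?thesis
      by (auto simp: subdivide_edges_def subdiv_point_def)
  next
    case False
    with that have "0 < i" "i < m" by auto
    with that show ?thesis by (auto simp: subdivide_edges_def)
  qed
  have rev: "(q, p) \<in> parcs (subdivide_edges m G)"
    if pq: "(p, q) \<in> parcs (subdivide_edges m G)" for p q
  proof -
    obtain u v i where *: "p = subdiv_point m u v i" "q = subdiv_point m u v (Suc i)"
      "(u, v) \<in> parcs G" "i < m" using pq by (auto simp: subdivide_edges_def)
    have "q = subdiv_point m v u (m - Suc i)" "p = subdiv_point m v u (Suc (m - Suc i))"
      using * assms(2) subdiv_point_rev[of m "Suc i" v u] subdiv_point_rev[of m i v u]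
      by (simp_all add: Suc_diff_Suc)
    moreover have "m - Suc i < m" using * by simp
    ultimately show ?thesis
      using sym[OF *(3)] by (auto simp: subdivide_edges_def)
  qed
  show ?thesis
  proof
    fix e assume "e \<in> parcs (subdivide_edges m G)"
    then obtain u v i where *: "e = (subdiv_point m u v i, subdiv_point m u v (Suc i))"
      "(u, v) \<in> parcs G" "i < m" by (auto simp: subdivide_edges_def)
    show "fst e \<in> pverts (subdivide_edges m G)" "snd e \<in> pverts (subdivide_edges m G)"
      using * pt by auto
    show "fst e \<noteq> snd e"
      using * neq[OF *(2)] by (auto simp: subdiv_point_def doubleton_eq_iff split: if_splits)
  next
    show "symmetric (with_proj (subdivide_edges m G))"
      using rev by (auto simp: symmetric_def intro!: symI)
  qed
qed

end

theory Submission
  imports Defs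
begin

text \<open>
  Let \<open>H\<close> be the graph with every edge of \<open>G\<close> subdivided into \<open>m \<ge> 2 * k + 2\<close> pieces. The cop
  plays on \<open>H\<close> by simulating a winning \<open>k\<close>-probe strategy for \<open>G\<close>, asking the \<open>k\<close> questions of one
  turn on \<open>G\<close> one after another. She probes branch vertices only. Three facts about the distance
  \<open>D\<close> from the robber to a branch vertex \<open>w\<close> make this work.

  \<^item> \<open>D\<close> is a multiple of \<open>m\<close> exactly when the robber is on a branch vertex, whichever \<open>w\<close> is
    (\<open>dvd_subdist_iff\<close>). So every answer reveals whether he is on one.
  \<^item> \<open>D\<close> changes by at most 1 per turn. If the robber is on the branch vertex \<open>u\<close> now, then each
    of the last \<open>k + 1\<close> answers differs by at most \<open>k < m / 2\<close> from the multiple \<open>m * d(u, w)\<close> of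
    \<open>m\<close>, where \<open>w\<close> is the vertex probed in that turn and \<open>d\<close> the distance in \<open>G\<close>. So \<open>d(u, w)\<close>
    is recovered by rounding (\<open>reading_correct\<close>). The cop thus learns the
    answers for \<open>u\<close> to questions asked before the robber arrived there, and she learns them while
    he stands on \<open>u\<close>. Locating \<open>u\<close> in \<open>G\<close> therefore locates the robber in \<open>H\<close>.
  \<^item> \<open>D < m\<close> exactly when the robber is on \<open>w\<close> or inside an edge at \<open>w\<close>.

  The probes have period \<open>k + 1\<close>: the \<open>k\<close> questions of the current simulated turn, followed by one
  sweeping probe, which runs through all vertices of \<open>G\<close> infinitely often. A simulated turn
  ends, at a \<^emph>\<open>checkpoint\<close>, when the robber is on a branch vertex and the last \<open>k + 1\<close> probes all
  belong to that turn. Between checkpoints he stays close to his last checkpoint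
  vertex, so at successive checkpoints he is on equal or adjacent vertices
  (\<open>consecutive_checkpoints\<close>) and his checkpoints form a legal play on \<open>G\<close> (\<open>shadow\<close>).

  If there are infinitely many checkpoints, the strategy for \<open>G\<close> locates the robber at one of them
  (\<open>located_by_recurring_checkpoints\<close>). Otherwise he is eventually confined to the inside of one
  edge forever. The sweep then probes both ends of this edge; the two answers are below \<open>m\<close>,
  which identifies the edge, and the second one gives his position on it (\<open>located_on_edge\<close>).
  The sweep needs \<open>G\<close> to be countable, and it is: the strategy for \<open>G\<close>
  must tell apart, by finite lists of natural numbers, the robbers that never move.
\<close>

section \<open>Graph distance as a potential\<close>

text \<open>
  A function that drops by at most 1 along arcs bounds the length of every walk to \<open>w\<close> from below;
  if it can always be decreased until \<open>w\<close> is reached, some walk attains the bound.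
\<close>

lemma (in pair_wf_digraph) gdist_eqI:
  fixes \<phi> :: "'a \<Rightarrow> nat"
  assumes w: "w \<in> pverts G" "\<phi> w = 0"
    and step: "\<And>x y. (x, y) \<in> parcs G \<Longrightarrow> \<phi> x \<le> Suc (\<phi> y)"
    and descent: "\<And>x. x \<in> pverts G \<Longrightarrow> x \<noteq> w \<Longrightarrow> \<exists>y. (x, y) \<in> parcs G \<and> \<phi> y < \<phi> x"
    and x: "x \<in> pverts G"
  shows "gdist G x w = ereal (real (\<phi> x))"
proof -
  have lower: "real (\<phi> x) \<le> awalk_cost (\<lambda>_. 1) p" if "awalk x p w" for x p
    using that
  proof (induction p arbitrary: x)
    case Nil
    then show ?case using w by (auto simp: awalk_Nil_iff)
  next
    case (Cons e p)
    then have "(x, snd e) \<in> parcs G" "awalk (snd e) p w"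
      by (auto simp: awalk_Cons_iff)
    then show ?case using Cons.IH[of "snd e"] step[of x "snd e"] by simp
  qed
  have upper: "\<exists>p. awalk x p w \<and> awalk_cost (\<lambda>_. 1) p \<le> real (\<phi> x)" if "x \<in> pverts G" for x
    using that
  proof (induction "\<phi> x" arbitrary: x rule: less_induct)
    case less
    show ?case
    proof (cases "x = w")
      case True
      then show ?thesis using w by (intro exI[of _ "[]"]) (auto simp: awalk_Nil_iff)
    next
      case False
      then obtain y where y: "(x, y) \<in> parcs G" "\<phi> y < \<phi> x" using descent less.prems by blast
      then obtain p where "awalk y p w" "awalk_cost (\<lambda>_. 1) p \<le> real (\<phi> y)"
        using less.hyps in_arcsD2 by blast
      with y less.prems show ?thesis
        by (intro exI[of _ "(x, y) # p"]) (auto simp: awalk_Cons_iff)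
    qed
  qed
  obtain p where p: "awalk x p w" "awalk_cost (\<lambda>_. 1) p \<le> real (\<phi> x)" using upper x by blast
  have "\<mu> (\<lambda>_. 1) x w = ereal (real (\<phi> x))"
  proof (rule antisym)
    show "\<mu> (\<lambda>_. 1) x w \<le> ereal (real (\<phi> x))"
      using min_cost_le_walk_cost[OF p(1), of "\<lambda>_. 1"] p(2) by (simp add: order_trans)
    show "ereal (real (\<phi> x)) \<le> \<mu> (\<lambda>_. 1) x w"
      unfolding \<mu>_def using lower by (auto intro!: INF_greatest)
  qed
  then show ?thesis by (simp add: gdist_def)
qed

locale connected_simple_graph = pair_bidirected_digraph G for G :: "'a pair_pre_digraph" +
  assumes connected: "connected (with_proj G)"
begin

definition hops :: "'a \<Rightarrow> 'a \<Rightarrow> nat" where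
  "hops u v = (LEAST n. \<exists>p. awalk u p v \<and> length p = n)"

lemma shortest_walk:
  assumes "u \<in> pverts G" "v \<in> pverts G"
  obtains p where "awalk u p v" "length p = hops u v"
proof -
  have "strongly_connected (with_proj G)"
    using symmetric_connected_imp_strongly_connected pair_sym_arcs connected by blast
  then have "\<exists>p. awalk u p v"
    using assms by (auto simp: strongly_connected_def reachable_awalk)
  then have "\<exists>n p. awalk u p v \<and> length p = n" by blast
  then have "\<exists>p. awalk u p v \<and> length p = hops u v"
    unfolding hops_def by (rule LeastI_ex)
  then show ?thesis using that by blast
qed

lemma hops_le: "awalk u p v \<Longrightarrow> hops u v \<le> length p"
  unfolding hops_def by (rule Least_le) blast

lemma hops_self [simp]: "u \<in> pverts G \<Longrightarrow> hops u u = 0"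
  using hops_le[of u "[]" u] by (simp add: awalk_Nil_iff)

lemma hops_arc:
  assumes "(u, v) \<in> parcs G" "w \<in> pverts G"
  shows "hops u w \<le> Suc (hops v w)"
proof -
  obtain p where p: "awalk v p w" "length p = hops v w"
    using shortest_walk in_arcsD2 assms by metis
  then have "awalk u ((u, v) # p) w" using assms in_arcsD1 by (auto simp: awalk_Cons_iff)
  then show ?thesis using hops_le[of u "(u, v) # p" w] p by simp
qed

text \<open>The second vertex of a shortest walk to \<open>w\<close> is one step closer to \<open>w\<close>.\<close>

lemma hops_descent:
  assumes "u \<in> pverts G" "w \<in> pverts G" "u \<noteq> w"
  obtains v where "(u, v) \<in> parcs G" "hops u w = Suc (hops v w)"
proof -
  obtain p where p: "awalk u p w" "length p = hops u w" using shortest_walk assms by metis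
  then obtain e q where "p = e # q" using assms by (cases p) (auto simp: awalk_Nil_iff)
  then have "(u, snd e) \<in> parcs G" "awalk (snd e) q w" "hops u w = Suc (length q)"
    using p by (auto simp: awalk_Cons_iff)
  then have "(u, snd e) \<in> parcs G" "hops u w = Suc (hops (snd e) w)"
    using hops_le[of "snd e" q w] hops_arc[of u "snd e" w] assms by auto
  then show ?thesis using that by blast
qed

lemma hops_eq_0_iff: "u \<in> pverts G \<Longrightarrow> w \<in> pverts G \<Longrightarrow> hops u w = 0 \<longleftrightarrow> u = w"
  by (metis hops_descent hops_self nat.simps(3))

lemma gdist_eq_hops: "u \<in> pverts G \<Longrightarrow> w \<in> pverts G \<Longrightarrow> gdist G u w = ereal (real (hops u w))"
  by (rule gdist_eqI[where \<phi> = "\<lambda>u. hops u w"]) (auto simp: hops_arc, metis hops_descent lessI)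

lemma equal_or_adjacent:
  assumes "u \<in> pverts G" "w \<in> pverts G" "hops w u \<le> 1"
  shows "w = u \<or> (u, w) \<in> parcs G"
proof (cases "w = u")
  case False
  then obtain v where "(w, v) \<in> parcs G" "hops w u = Suc (hops v u)"
    using hops_descent assms by metis
  then show ?thesis using assms hops_eq_0_iff[of v u] in_arcsD2 graph_symmetric by auto
qed simp

end

section \<open>Distances to branch vertices of the subdivision\<close>

locale subdivided_graph = connected_simple_graph G for G :: "'a pair_pre_digraph" +
  fixes m :: nat
  assumes m_pos: "m > 0"
begin

abbreviation H :: "'a subdiv_vertex pair_pre_digraph" where "H \<equiv> subdivide_edges m G"

text \<open>
  The distance to \<open>Branch w\<close>: the label \<open>{(u, i), (v, m - i)}\<close> of an inner vertex records how far
  away the two ends of its edge are, and a shortest walk leaves the edge through one of them.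
\<close>

fun subdist :: "'a \<Rightarrow> 'a subdiv_vertex \<Rightarrow> nat" where
  "subdist w (Branch u) = m * hops u w"
| "subdist w (Inner S) = Min ((\<lambda>(z, i). i + m * hops z w) ` S)"

text \<open>
  The same formula covers the ends \<open>i = 0\<close> and \<open>i = m\<close> of the path, where the end itself attains
  the minimum because hop distances of neighbours differ by at most 1.
\<close>

lemma subdist_point:
  assumes "(u, v) \<in> parcs G" "w \<in> pverts G" "i \<le> m"
  shows "subdist w (subdiv_point m u v i) = min (i + m * hops u w) (m - i + m * hops v w)"
proof -
  have "m * hops u w \<le> m + m * hops v w" "m * hops v w \<le> m + m * hops u w"
    using mult_le_mono2[OF hops_arc[of u v w], of m] mult_le_mono2[OF hops_arc[of v u w], of m]
      graph_symmetric assms by auto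
  then show ?thesis using assms by (auto simp: subdiv_point_def)
qed

lemma H_vertex_cases [consumes 1, case_names Branch Inner]:
  assumes "x \<in> pverts H"
  obtains u where "x = Branch u" "u \<in> pverts G"
  | u v i where "(u, v) \<in> parcs G" "0 < i" "i < m" "x = subdiv_point m u v i"
  using assms by (auto simp: subdivide_edges_def)

lemma Branch_in_H_iff [simp]: "Branch u \<in> pverts H \<longleftrightarrow> u \<in> pverts G"
  by (auto simp: subdivide_edges_def subdiv_point_def)

lemma subdist_arc:
  assumes "(x, y) \<in> parcs H" "w \<in> pverts G"
  shows "subdist w x \<le> Suc (subdist w y)" "subdist w y \<le> Suc (subdist w x)"
proof -
  obtain u v i where *: "x = subdiv_point m u v i" "y = subdiv_point m u v (Suc i)"
    "(u, v) \<in> parcs G" "i < m" using assms by (auto simp: subdivide_edges_def)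
  then show "subdist w x \<le> Suc (subdist w y)" "subdist w y \<le> Suc (subdist w x)"
    using assms by (auto simp: subdist_point min_def)
qed

lemma point_arc_down:
  assumes "(u, v) \<in> parcs G" "0 < i" "i \<le> m"
  shows "(subdiv_point m u v i, subdiv_point m u v (i - 1)) \<in> parcs H"
proof -
  have "subdiv_point m u v i = subdiv_point m v u (m - i)"
    "subdiv_point m u v (i - 1) = subdiv_point m v u (Suc (m - i))"
    using subdiv_point_rev[of m i v u] subdiv_point_rev[of m "i - 1" v u] assms
    by (simp_all add: Suc_diff_le[symmetric] m_pos)
  moreover have "m - i < m" using assms by simp
  ultimately show ?thesis using graph_symmetric[OF assms(1)] by (auto simp: subdivide_edges_def)
qed

text \<open>
  At a branch vertex one steps onto the edge that starts a shortest walk in \<open>G\<close>, inside an edge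
  one steps towards the end at which the minimum is attained.
\<close>

lemma subdist_descent:
  assumes "x \<in> pverts H" "w \<in> pverts G" "x \<noteq> Branch w"
  shows "\<exists>y. (x, y) \<in> parcs H \<and> subdist w y < subdist w x"
  using assms(1)
proof (cases rule: H_vertex_cases)
  case (Branch u)
  then obtain v where v: "(u, v) \<in> parcs G" "hops u w = Suc (hops v w)"
    using hops_descent[of u w] assms by blast
  have "(subdiv_point m u v 0, subdiv_point m u v 1) \<in> parcs H"
    using v m_pos by (auto simp: subdivide_edges_def)
  moreover have "subdist w (subdiv_point m u v 1) < subdist w x"
    using v m_pos assms Branch by (simp add: subdist_point)
  ultimately show ?thesis using Branch by (auto simp: subdiv_point_def)
next
  case (Inner u v i)
  have down: "\<exists>y. (x, y) \<in> parcs H \<and> subdist w y < subdist w x"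
    if "(u, v) \<in> parcs G" "0 < i" "i < m" "x = subdiv_point m u v i"
      "i + m * hops u w \<le> m - i + m * hops v w" for u v i
    using that point_arc_down[of u v i] assms
    by (intro exI[of _ "subdiv_point m u v (i - 1)"]) (auto simp: subdist_point min_def)
  show ?thesis
  proof (cases "i + m * hops u w \<le> m - i + m * hops v w")
    case True
    then show ?thesis using down Inner by blast
  next
    case False
    then show ?thesis
      using down[of v u "m - i"] Inner graph_symmetric subdiv_point_rev[of m i v u] m_pos by auto
  qed
qed

lemma gdist_eq_subdist:
  assumes "x \<in> pverts H" "w \<in> pverts G"
  shows "gdist H x (Branch w) = ereal (real (subdist w x))"
proof -
  interpret H: pair_bidirected_digraph H
    using subdivide_edges_bidirected pair_bidirected_digraph_axioms m_pos by blast
  show ?thesis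
    by (rule H.gdist_eqI) (use assms in \<open>auto simp: subdist_arc intro: subdist_descent\<close>)
qed

text \<open>
  Modulo \<open>m\<close>, the distance from the \<open>i\<close>-th point of an edge is \<open>i\<close> or \<open>-i\<close>, for any target.
\<close>

lemma dvd_subdist_iff:
  assumes "x \<in> pverts H" "w \<in> pverts G"
  shows "m dvd subdist w x \<longleftrightarrow> (\<exists>u\<in>pverts G. x = Branch u)"
  using assms(1)
proof (cases rule: H_vertex_cases)
  case (Inner u v i)
  have "\<not> m dvd i" "\<not> m dvd (m - i)" using Inner by (auto dest: dvd_imp_le)
  then have "\<not> m dvd (i + m * hops u w)" "\<not> m dvd (m - i + m * hops v w)"
    by (metis dvd_add_left_iff dvd_triv_left)+
  then have "\<not> m dvd subdist w x"
    unfolding Inner(4) using subdist_point[of u v w i] Inner assms by (auto simp only: min_def split: if_splits)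
  then show ?thesis using Inner by (auto simp: subdiv_point_def)
qed auto

lemma subdist_move:
  assumes "robber_play H r" "w \<in> pverts G"
  shows "subdist w (r (t + s)) \<le> subdist w (r t) + s"
    and "subdist w (r t) \<le> subdist w (r (t + s)) + s"
proof (induction s)
  case (Suc s)
  have "r (Suc (t + s)) = r (t + s) \<or> (r (t + s), r (Suc (t + s))) \<in> parcs H"
    using assms by (auto simp: robber_play_def)
  then have "subdist w (r (Suc (t + s))) \<le> Suc (subdist w (r (t + s)))"
    "subdist w (r (t + s)) \<le> Suc (subdist w (r (Suc (t + s))))"
    using subdist_arc assms by auto
  with Suc show "subdist w (r (t + Suc s)) \<le> subdist w (r t) + Suc s"
    "subdist w (r t) \<le> subdist w (r (t + Suc s)) + Suc s" by auto
qed auto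

lemma inner_ends:
  assumes "x \<in> pverts H" "\<nexists>u. x = Branch u"
  obtains u v where "u \<in> pverts G" "v \<in> pverts G" "u \<noteq> v" "subdist u x < m" "subdist v x < m"
  using assms(1)
proof (cases rule: H_vertex_cases)
  case (Inner u v i)
  have V: "u \<in> pverts G" "v \<in> pverts G" using Inner in_arcsD1 in_arcsD2 by auto
  moreover have "subdist u x < m" "subdist v x < m"
    using Inner V by (auto simp: subdist_point min_less_iff_disj)
  ultimately show ?thesis using that[of u v] no_loops'[OF Inner(1)] by blast
qed (use assms in auto)

text \<open>
  From inside an edge only its two ends are closer than \<open>m\<close>, so two different such vertices
  determine the edge, and the distance to one of them the position on it.
\<close>

lemma near_two_ends:
  assumes "x \<in> pverts H" "\<nexists>u. x = Branch u" "u \<in> pverts G" "v \<in> pverts G" "u \<noteq> v"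
    and near: "subdist u x < m" "subdist v x < m"
  shows "x = subdiv_point m v u (subdist v x)"
  using assms(1)
proof (cases rule: H_vertex_cases)
  case (Inner a b i)
  have V: "a \<in> pverts G" "b \<in> pverts G" using Inner in_arcsD1 in_arcsD2 by auto
  have end_near: "w = a \<or> w = b" if "w \<in> pverts G" "subdist w x < m" for w
  proof -
    have "hops a w = 0 \<or> hops b w = 0"
      using that Inner
      by (cases "hops a w"; cases "hops b w") (auto simp: subdist_point min_less_iff_disj)
    then show ?thesis using hops_eq_0_iff V that by blast
  qed
  have "hops a b \<noteq> 0" "hops b a \<noteq> 0"
    using hops_eq_0_iff[of a b] hops_eq_0_iff[of b a] V no_loops'[OF Inner(1)] by auto
  then have "m \<le> m * hops a b" "m \<le> m * hops b a" by auto
  moreover have "subdist a x = min i (m - i + m * hops b a)"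
    "subdist b x = min (i + m * hops a b) (m - i)"
    using Inner V by (simp_all add: subdist_point)
  ultimately have "subdist a x = i" "subdist b x = m - i" using Inner(3) by linarith+
  moreover have "{u, v} = {a, b}"
    using end_near[OF assms(3) near(1)] end_near[OF assms(4) near(2)] \<open>u \<noteq> v\<close> by auto
  ultimately show ?thesis
    using Inner subdiv_point_rev[of m i b a] m_pos by (auto simp: doubleton_eq_iff)
qed (use assms in auto)

end

section \<open>Single-probe strategies given by their runs\<close>

text \<open>
  A rule \<open>p\<close> for a single probe per turn reads the infinite sequence \<open>a\<close> of answers. It is a
  strategy once it is causal, that is, its probe in turn \<open>t\<close> depends on the answers before \<open>t\<close>
  only. This form avoids handling finite histories.
\<close>

definition probe_run ::
  "'b pair_pre_digraph \<Rightarrow> ((nat \<Rightarrow> ereal) \<Rightarrow> nat \<Rightarrow> 'b) \<Rightarrow> (nat \<Rightarrow> 'b) \<Rightarrow> (nat \<Rightarrow> ereal) \<Rightarrow> bool"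
  where "probe_run H p r a \<longleftrightarrow> robber_play H r \<and> (\<forall>t. gdist H (r t) (p a t) = a t)"

lemma locatable_by_causal_probing:
  fixes p :: "(nat \<Rightarrow> ereal) \<Rightarrow> nat \<Rightarrow> 'b"
  assumes causal: "\<And>a b t. (\<And>i. i < t \<Longrightarrow> a i = b i) \<Longrightarrow> p a t = p b t"
    and in_graph: "\<And>a t. p a t \<in> pverts H"
    and win: "\<And>r a. probe_run H p r a \<Longrightarrow>
      \<exists>T. \<forall>r' a'. probe_run H p r' a' \<longrightarrow> (\<forall>i\<le>T. a' i = a i) \<longrightarrow> r' T = r T"
  shows "locatable H"
proof -
  define \<sigma> where "\<sigma> h = [p (\<lambda>i. hd (h ! i)) (length h)]" for h
  define ans where "ans r i = hd (answers H \<sigma> r (Suc i) ! i)" for r i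
  have len: "length (answers H \<sigma> r t) = t" for r t
    by (induction t) auto
  have answers_eq: "answers H \<sigma> r t = map (\<lambda>i. [ans r i]) [0..<t]" for r t
  proof (induction t)
    case (Suc t)
    have "ans r t = gdist H (r t) (p (\<lambda>i. hd (answers H \<sigma> r t ! i)) t)"
      unfolding ans_def by (simp add: nth_append len \<sigma>_def)
    then show ?case using Suc by (simp add: \<sigma>_def len)
  qed simp
  have run: "probe_run H p r (ans r)" if "robber_play H r" for r
    unfolding probe_run_def
  proof (intro conjI allI)
    fix t
    have "ans r t = gdist H (r t) (p (\<lambda>i. hd (answers H \<sigma> r t ! i)) t)"
      unfolding ans_def by (simp add: nth_append len \<sigma>_def)
    also have "p (\<lambda>i. hd (answers H \<sigma> r t ! i)) t = p (ans r) t"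
      by (rule causal) (simp add: answers_eq)
    finally show "gdist H (r t) (p (ans r) t) = ans r t" ..
  qed (use that in simp)
  have "\<exists>T. located_at H \<sigma> r T" if r: "robber_play H r" for r
  proof -
    obtain T where T: "\<And>r' a'. probe_run H p r' a' \<Longrightarrow> (\<forall>i\<le>T. a' i = ans r i) \<Longrightarrow> r' T = r T"
      using win[OF run[OF r]] by blast
    have "r' T = r T"
      if r': "robber_play H r'" "answers H \<sigma> r' (Suc T) = answers H \<sigma> r (Suc T)" for r'
    proof (rule T[OF run[OF r'(1)]], intro allI impI)
      fix i assume "i \<le> T"
      have "map (\<lambda>i. [ans r' i]) [0..<Suc T] ! i = map (\<lambda>i. [ans r i]) [0..<Suc T] ! i"
        using r'(2) by (simp only: answers_eq)
      then show "ans r' i = ans r i" using \<open>i \<le> T\<close> by (simp del: upt_Suc)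
    qed
    then show ?thesis unfolding located_at_def by blast
  qed
  moreover have "probe_strategy 1 H \<sigma>"
    unfolding probe_strategy_def \<sigma>_def using in_graph by simp
  ultimately show ?thesis unfolding locatable_def k_locatable_def by blast
qed

text \<open>
  A robber who never moves is located after finitely many answers, which are natural
  numbers. If he is located with a list of answers at \<open>v\<close>, no other motionless robber produces
  this list, so vertices inject into finite lists of finite lists of natural numbers.
\<close>

lemma (in connected_simple_graph) countable_if_locatable:
  assumes "k_locatable k G"
  shows "countable (pverts G)"
proof -
  obtain \<sigma> where \<sigma>: "probe_strategy k G \<sigma>" "\<And>r. robber_play G r \<Longrightarrow> \<exists>t. located_at G \<sigma> r t"
    using assms unfolding k_locatable_def by blast
  have static: "robber_play G (\<lambda>_. v)" if "v \<in> pverts G" for v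
    using that by (simp add: robber_play_def)
  define T where "T v = (SOME t. located_at G \<sigma> (\<lambda>_. v) t)" for v
  have T: "located_at G \<sigma> (\<lambda>_. v) (T v)" if "v \<in> pverts G" for v
    unfolding T_def using \<sigma>(2)[OF static[OF that]] by (rule someI_ex)
  define f where "f v = answers G \<sigma> (\<lambda>_. v) (Suc (T v))" for v
  have len: "length (answers G \<sigma> r t) = t" for r t
    by (induction t) auto
  have "inj_on f (pverts G)"
  proof (rule inj_onI)
    fix u v assume *: "u \<in> pverts G" "v \<in> pverts G" "f u = f v"
    have "T u = T v" using arg_cong[OF *(3), of length] by (simp add: f_def len del: answers.simps)
    then show "u = v" using * T[of v] static[of u] unfolding located_at_def f_def by metis
  qed
  define D where "D = range (\<lambda>n. ereal (real n))"
  have "set (answers G \<sigma> (\<lambda>_. v) t) \<subseteq> lists D" if "v \<in> pverts G" for v t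
  proof (induction t)
    case (Suc t)
    have "gdist G v u \<in> D" if "u \<in> set (\<sigma> h)" for u h
      using that \<sigma>(1) \<open>v \<in> pverts G\<close> gdist_eq_hops unfolding probe_strategy_def D_def by blast
    then show ?case using Suc by auto
  qed simp
  then have "f ` pverts G \<subseteq> lists (lists D)" unfolding f_def by fastforce
  moreover have "countable (lists (lists D))" unfolding D_def by auto
  ultimately have "countable (f ` pverts G)" by (rule countable_subset)
  then show ?thesis using \<open>inj_on f (pverts G)\<close> by (rule countable_image_inj_on)
qed

text \<open>
  Reading \<open>n\<close> as the code of a pair and ignoring the second component repeats every element
  infinitely often.
\<close>

lemma recurrent_enumeration:
  assumes "countable A" "A \<noteq> {}"
  obtains e :: "nat \<Rightarrow> 'b" where "range e \<subseteq> A" "\<And>v N. v \<in> A \<Longrightarrow> \<exists>n\<ge>N. e n = v"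
proof (rule that)
  let ?e = "\<lambda>n. from_nat_into A (fst (prod_decode n))"
  show "range ?e \<subseteq> A" using from_nat_into[OF assms(2)] by auto
  show "\<exists>n\<ge>N. ?e n = v" if "v \<in> A" for v N
    using that assms
    by (intro exI[of _ "prod_encode (to_nat_on A v, N)"]) (simp add: le_prod_encode_2)
qed

section \<open>Simulating the strategy for the original graph\<close>

locale simulated_strategy = subdivided_graph G m for G :: "'a pair_pre_digraph" and m +
  fixes k :: nat and \<sigma> :: "'a strategy" and sweep :: "nat \<Rightarrow> 'a"
  assumes m_ge: "2 * k + 2 \<le> m"
    and strategy: "probe_strategy k G \<sigma>"
    and winning: "\<And>\<rho>. robber_play G \<rho> \<Longrightarrow> \<exists>t. located_at G \<sigma> \<rho> t"
    and sweep_in: "sweep n \<in> pverts G"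
    and sweep_recurrent: "v \<in> pverts G \<Longrightarrow> \<exists>n\<ge>N. sweep n = v"
begin

text \<open>
  The number of turns completed since the last checkpoint (or since the start). A checkpoint
  requires \<open>gap a t \<ge> k\<close>, so that the turns \<open>t - k, \<dots>, t\<close>, a full period of probes, all
  lie after the previous checkpoint.
\<close>

primrec gap :: "(nat \<Rightarrow> nat) \<Rightarrow> nat \<Rightarrow> nat" where
  "gap a 0 = 0"
| "gap a (Suc t) = (if k \<le> gap a t \<and> m dvd a t then 0 else Suc (gap a t))"

definition checkpoint :: "(nat \<Rightarrow> nat) \<Rightarrow> nat \<Rightarrow> bool" where
  "checkpoint a t \<longleftrightarrow> k \<le> gap a t \<and> m dvd a t"

text \<open>For \<open>j \<le> t\<close>, the last turn up to \<open>t\<close> that is congruent to \<open>j\<close> modulo the period \<open>k + 1\<close>.\<close>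

definition slot_time :: "nat \<Rightarrow> nat \<Rightarrow> nat" where
  "slot_time t j = j + Suc k * ((t - j) div Suc k)"

text \<open>
  The answers to the simulated turn that ends at \<open>t\<close>. Adding \<open>k\<close> before dividing rounds to the
  correct multiple of \<open>m\<close>, as the error is at most \<open>k\<close> in either direction and \<open>2 * k < m\<close>.
\<close>

definition reading :: "(nat \<Rightarrow> nat) \<Rightarrow> nat \<Rightarrow> ereal list" where
  "reading a t = map (\<lambda>j. ereal (real ((a (slot_time t j) + k) div m))) [0..<k]"

text \<open>The history of the simulated game on \<open>G\<close> before turn \<open>t\<close>.\<close>

primrec hist :: "(nat \<Rightarrow> nat) \<Rightarrow> nat \<Rightarrow> ereal list list" where
  "hist a 0 = []"
| "hist a (Suc t) = (if checkpoint a t then hist a t @ [reading a t] else hist a t)"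

definition target :: "(nat \<Rightarrow> nat) \<Rightarrow> nat \<Rightarrow> 'a" where
  "target a t =
     (if t mod Suc k < k then \<sigma> (hist a t) ! (t mod Suc k) else sweep (t div Suc k))"

lemma gap_Suc: "gap a (Suc t) = (if checkpoint a t then 0 else Suc (gap a t))"
  by (simp add: checkpoint_def)

lemma gap_le: "gap a t \<le> t"
  by (induction t) auto

lemma slot_time:
  assumes "j < k" "k \<le> t"
  shows "slot_time t j \<le> t" "t \<le> slot_time t j + k" "slot_time t j mod Suc k = j"
proof -
  have "Suc k * ((t - j) div Suc k) + (t - j) mod Suc k = t - j" by (rule mult_div_mod_eq)
  moreover have "(t - j) mod Suc k \<le> k" using mod_less_divisor[of "Suc k" "t - j"] by simp
  ultimately show "slot_time t j \<le> t" "t \<le> slot_time t j + k"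
    using assms unfolding slot_time_def by linarith+
  show "slot_time t j mod Suc k = j" using assms unfolding slot_time_def by (simp del: mult_Suc)
qed

lemma causal:
  assumes "\<And>i. i < t \<Longrightarrow> a i = b i"
  shows "gap a t = gap b t" "hist a t = hist b t"
proof -
  have "gap a t = gap b t \<and> hist a t = hist b t" using assms
  proof (induction t)
    case (Suc t)
    then have IH: "gap a t = gap b t" "hist a t = hist b t" and t: "a t = b t" by auto
    then have ev: "checkpoint a t = checkpoint b t" by (simp add: checkpoint_def)
    have "reading a t = reading b t" if "checkpoint a t"
    proof -
      have "k \<le> t" using that gap_le[of a t] unfolding checkpoint_def by linarith
      then have "a (slot_time t j) = b (slot_time t j)" if "j < k" for j
        using Suc.prems[of "slot_time t j"] slot_time(1)[OF that \<open>k \<le> t\<close>] by simp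
      then show ?thesis unfolding reading_def by simp
    qed
    then show ?case using IH ev by (simp add: gap_Suc del: gap.simps)
  qed simp
  then show "gap a t = gap b t" "hist a t = hist b t" by auto
qed

lemma checkpoint_causal:
  assumes "\<And>i. i \<le> t \<Longrightarrow> a i = b i"
  shows "checkpoint a t = checkpoint b t"
  using causal(1)[of t a b] assms by (simp add: checkpoint_def)

lemma hist_in_gap: "s \<le> t \<Longrightarrow> t \<le> s + gap a t \<Longrightarrow> hist a s = hist a t"
proof (induction t)
  case (Suc t)
  then show ?case by (cases "s = Suc t") (auto simp: gap_Suc simp del: gap.simps split: if_splits)
qed simp

lemma hist_without_checkpoint:
  "s \<le> t \<Longrightarrow> (\<And>i. s \<le> i \<Longrightarrow> i < t \<Longrightarrow> \<not> checkpoint a i) \<Longrightarrow> hist a t = hist a s"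
  by (induction t) (auto simp: le_Suc_eq)

lemma hist_length_mono: "s \<le> t \<Longrightarrow> length (hist a s) \<le> length (hist a t)"
  by (induction t) (auto simp: le_Suc_eq)

text \<open>
  The length of the simulated history increases exactly at checkpoints, so it can serve as
  their index.
\<close>

lemma checkpoint_determined:
  assumes "checkpoint a s" "checkpoint a t" "length (hist a s) = length (hist a t)"
  shows "s = t"
proof (rule ccontr)
  have *: False if "s < t" "checkpoint a s" "length (hist a s) = length (hist a t)" for s t
    using hist_length_mono[of "Suc s" t a] that by simp
  assume "s \<noteq> t"
  then show False using *[of s t] *[of t s] assms by (auto simp: neq_iff)
qed

lemma previous_checkpoint:
  "length (hist a t) = Suc j \<Longrightarrow>
   \<exists>s<t. checkpoint a s \<and> length (hist a s) = j \<and> (\<forall>i. s < i \<and> i < t \<longrightarrow> \<not> checkpoint a i)"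
proof (induction t)
  case (Suc t)
  show ?case
  proof (cases "checkpoint a t")
    case True
    then show ?thesis using Suc.prems by (intro exI[of _ t]) auto
  next
    case False
    then obtain s where "s < t" "checkpoint a s" "length (hist a s) = j"
      "\<forall>i. s < i \<and> i < t \<longrightarrow> \<not> checkpoint a i" using Suc by auto
    then show ?thesis using False by (intro exI[of _ s]) (auto simp: less_Suc_eq)
  qed
qed simp

lemma checkpoint_of_each_length:
  assumes "\<And>N. \<exists>t\<ge>N. checkpoint a t"
  shows "\<exists>t. checkpoint a t \<and> length (hist a t) = j"
proof -
  have next_checkpoint: "\<exists>t. checkpoint a t \<and> length (hist a t) = length (hist a s)" for s
  proof -
    define t where "t = (LEAST t. s \<le> t \<and> checkpoint a t)"
    have "s \<le> t \<and> checkpoint a t" unfolding t_def using assms[of s] by (rule LeastI_ex)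
    moreover have "\<not> checkpoint a i" if "s \<le> i" "i < t" for i
      using not_less_Least[of i "\<lambda>t. s \<le> t \<and> checkpoint a t"] that unfolding t_def by blast
    ultimately show ?thesis using hist_without_checkpoint[of s t a] by auto
  qed
  show ?thesis
  proof (induction j)
    case 0
    then show ?case using next_checkpoint[of 0] by simp
  next
    case (Suc j)
    then obtain t where "checkpoint a t" "length (hist a t) = j" by blast
    then show ?case using next_checkpoint[of "Suc t"] by simp
  qed
qed

lemma length_probes: "length (\<sigma> h) = k" and probes_in: "set (\<sigma> h) \<subseteq> pverts G"
  using strategy by (auto simp: probe_strategy_def)

lemma target_in: "target a t \<in> pverts G"
proof (cases "t mod Suc k < k")
  case True
  then show ?thesis unfolding target_def
    using probes_in[of "hist a t"] length_probes[of "hist a t"] by (auto simp: subset_iff)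
qed (simp add: target_def sweep_in)

definition run :: "(nat \<Rightarrow> 'a subdiv_vertex) \<Rightarrow> (nat \<Rightarrow> nat) \<Rightarrow> bool" where
  "run r a \<longleftrightarrow> robber_play H r \<and> (\<forall>t. a t = subdist (target a t) (r t))"

context
  fixes r a
  assumes run: "run r a"
begin

lemma play: "robber_play H r" and answer: "a t = subdist (target a t) (r t)"
  using run by (auto simp: run_def)

lemma r_in: "r t \<in> pverts H"
  using play by (simp add: robber_play_def)

lemma dvd_answer_iff: "m dvd a t \<longleftrightarrow> (\<exists>u\<in>pverts G. r t = Branch u)"
  unfolding answer[of t] by (rule dvd_subdist_iff[OF r_in target_in])

text \<open>
  The answers were given in the last \<open>k + 1\<close> turns, but the distance to a probed vertex \<open>w\<close> has
  changed by at most \<open>k\<close> since, so each of them still rounds to the distance from \<open>u\<close> to \<open>w\<close>.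
\<close>

lemma reading_correct:
  assumes "checkpoint a t" "r t = Branch u" "u \<in> pverts G"
  shows "reading a t = map (gdist G u) (\<sigma> (hist a t))"
proof (rule nth_equalityI)
  fix j assume "j < length (reading a t)"
  then have j: "j < k" by (simp add: reading_def)
  have k: "k \<le> gap a t" "k \<le> t" using assms(1) gap_le[of a t] by (auto simp: checkpoint_def)
  \<comment> \<open>Question \<open>j\<close> was asked in turn \<open>\<tau>\<close>, when the simulated history was already the present one.\<close>
  define \<tau> w where "\<tau> = slot_time t j" and "w = \<sigma> (hist a t) ! j"
  have \<tau>: "\<tau> \<le> t" "t \<le> \<tau> + k" "\<tau> mod Suc k = j" using slot_time[OF j k(2)] by (auto simp: \<tau>_def)
  have "hist a \<tau> = hist a t" using \<tau> k by (intro hist_in_gap) auto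
  then have "target a \<tau> = w" using \<tau> j by (simp add: target_def w_def)
  have w: "w \<in> pverts G"
    using probes_in[of "hist a t"] length_probes[of "hist a t"] j by (auto simp: w_def)
  have "subdist w (r t) \<le> subdist w (r \<tau>) + k" "subdist w (r \<tau>) \<le> subdist w (r t) + k"
    using subdist_move[OF play w, of \<tau> "t - \<tau>"] \<tau> by auto
  then have "m * hops u w \<le> a \<tau> + k" "a \<tau> + k \<le> m * hops u w + 2 * k"
    using \<open>target a \<tau> = w\<close> assms answer[of \<tau>] by auto
  then have "(a \<tau> + k) div m = hops u w"
    using m_ge by (intro div_nat_eqI) (auto simp: algebra_simps)
  then show "reading a t ! j = map (gdist G u) (\<sigma> (hist a t)) ! j"
    using j w assms length_probes[of "hist a t"]
    by (simp add: reading_def \<tau>_def w_def gdist_eq_hops)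
qed (simp add: reading_def length_probes)

text \<open>
  After a checkpoint at \<open>u\<close> the distance to \<open>u\<close> stays below \<open>m\<close> until the next one. It could only
  leave this range through the value \<open>m\<close>, that is, at a branch vertex. For the first \<open>k\<close> turns
  there is not enough time to get there; later every branch vertex would be a checkpoint.
\<close>

lemma near_until_next_checkpoint:
  assumes "checkpoint a s" "r s = Branch u" "u \<in> pverts G"
  shows "(\<And>i. s < i \<Longrightarrow> i \<le> s + n \<Longrightarrow> \<not> checkpoint a i) \<Longrightarrow>
    gap a (Suc (s + n)) = n \<and> subdist u (r (s + n)) < m"
proof (induction n)
  case 0
  then show ?case using assms m_pos by (simp add: gap_Suc del: gap.simps)
next
  case (Suc n)
  let ?t = "Suc (s + n)"
  have IH: "gap a ?t = n" "subdist u (r (s + n)) < m" using Suc by auto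
  have no_checkpoint: "\<not> checkpoint a ?t" using Suc.prems[of ?t] by simp
  have le: "subdist u (r ?t) \<le> m"
    using subdist_move(1)[OF play assms(3), of "s + n" 1] IH by simp
  have "subdist u (r ?t) \<noteq> m"
  proof (cases "n < k")
    case True
    then show ?thesis
      using subdist_move(1)[OF play assms(3), of s "Suc n"] assms m_ge by simp
  next
    case False
    then have "\<not> m dvd a ?t" using no_checkpoint IH by (simp add: checkpoint_def del: gap.simps)
    then show ?thesis
      unfolding dvd_answer_iff dvd_subdist_iff[OF r_in assms(3), symmetric] by auto
  qed
  with le no_checkpoint IH show ?case by (simp add: gap_Suc del: gap.simps)
qed

lemma consecutive_checkpoints:
  assumes "checkpoint a s" "r s = Branch u" "u \<in> pverts G"
    and "checkpoint a t" "r t = Branch v" "v \<in> pverts G"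
    and "s < t" "\<And>i. s < i \<Longrightarrow> i < t \<Longrightarrow> \<not> checkpoint a i"
  shows "v = u \<or> (u, v) \<in> parcs G"
proof -
  obtain n where t: "t = Suc (s + n)" using less_imp_Suc_add[OF \<open>s < t\<close>] by blast
  have "subdist u (r (s + n)) < m"
    using near_until_next_checkpoint[OF assms(1-3), of n] assms(8) t by simp
  then have "subdist u (r t) \<le> m"
    using subdist_move(1)[OF play assms(3), of "s + n" 1] t by simp
  then have "hops v u \<le> 1" using assms m_pos by simp
  then show ?thesis using equal_or_adjacent assms by blast
qed

text \<open>
  The robber's positions at the checkpoints, in order, form a play \<open>\<rho>\<close> on \<open>G\<close> whose answers are
  the simulated history. If there are only finitely many checkpoints, \<open>\<rho>\<close> stays
  at the last one, and it stays at an arbitrary vertex if there are none.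
\<close>

lemma shadow:
  obtains \<rho> where "robber_play G \<rho>" "\<And>t. answers G \<sigma> \<rho> (length (hist a t)) = hist a t"
    "\<And>t. checkpoint a t \<Longrightarrow> r t = Branch (\<rho> (length (hist a t)))"
proof -
  let ?n = "\<lambda>t. length (hist a t)"
  obtain v0 where v0: "v0 \<in> pverts G" using target_in by blast
  define visit where "visit j u \<longleftrightarrow> u \<in> pverts G \<and> (\<exists>t. checkpoint a t \<and> ?n t = j \<and> r t = Branch u)" for j u
  define \<rho> where "\<rho> = rec_nat (if \<exists>u. visit 0 u then SOME u. visit 0 u else v0)
    (\<lambda>j x. if \<exists>u. visit (Suc j) u then SOME u. visit (Suc j) u else x)"
  have visit_ex: "\<exists>u. visit (?n t) u \<and> r t = Branch u" if "checkpoint a t" for t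
    using that dvd_answer_iff[of t] unfolding visit_def checkpoint_def by blast
  have visit_unique: "u = v" if "visit j u" "visit j v" for j u v
    using that checkpoint_determined unfolding visit_def by (metis subdiv_vertex.inject(1))
  have \<rho>_visit: "\<rho> j = u" if "visit j u" for j u
  proof -
    have "(SOME u. visit j u) = u" using that visit_unique by blast
    then show ?thesis using that unfolding \<rho>_def by (cases j) auto
  qed
  have \<rho>_Suc: "\<rho> (Suc j) = (if \<exists>u. visit (Suc j) u then SOME u. visit (Suc j) u else \<rho> j)" for j
    unfolding \<rho>_def by simp
  have \<rho>_stay: "\<rho> (Suc j) = \<rho> j" if "\<nexists>u. visit (Suc j) u" for j
    by (simp only: \<rho>_Suc that if_False)
  have \<rho>_checkpoint: "r t = Branch (\<rho> (?n t))" "\<rho> (?n t) \<in> pverts G" if "checkpoint a t" for t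
    using visit_ex[OF that] \<rho>_visit visit_def by auto
  have \<rho>_in: "\<rho> j \<in> pverts G" for j
  proof (induction j)
    case 0
    have "\<rho> 0 = (if \<exists>u. visit 0 u then SOME u. visit 0 u else v0)" unfolding \<rho>_def by simp
    then show ?case using \<rho>_visit[of 0] v0 visit_def by metis
  next
    case (Suc j)
    then show ?case using \<rho>_visit[of "Suc j"] \<rho>_stay visit_def by metis
  qed
  have \<rho>_step: "\<rho> (Suc j) = \<rho> j \<or> (\<rho> j, \<rho> (Suc j)) \<in> parcs G" for j
  proof (cases "\<exists>u. visit (Suc j) u")
    case True
    then obtain t where t: "checkpoint a t" "?n t = Suc j" unfolding visit_def by blast
    then obtain s where s: "s < t" "checkpoint a s" "?n s = j" "\<And>i. s < i \<Longrightarrow> i < t \<Longrightarrow> \<not> checkpoint a i"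
      using previous_checkpoint by blast
    then show ?thesis
      using consecutive_checkpoints[of s "\<rho> j" t "\<rho> (Suc j)"] \<rho>_checkpoint[of s] \<rho>_checkpoint[of t] t by auto
  qed (use \<rho>_stay in blast)
  have "answers G \<sigma> \<rho> (?n t) = hist a t" for t
  proof (induction t)
    case (Suc t)
    then show ?case using reading_correct[of t "\<rho> (?n t)"] \<rho>_checkpoint[of t] by simp
  qed simp
  moreover have "robber_play G \<rho>" using \<rho>_in \<rho>_step by (simp add: robber_play_def)
  ultimately show thesis using that \<rho>_checkpoint by blast
qed

text \<open>A robber inside an edge at \<open>w\<close> stays there as long as he meets no branch vertex.\<close>

lemma remains_near:
  assumes "w \<in> pverts G" "s \<le> t" "subdist w (r s) < m"
    and "\<And>i. s \<le> i \<Longrightarrow> i \<le> t \<Longrightarrow> \<not> m dvd a i"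
  shows "subdist w (r t) < m"
  using assms(2,4)
proof (induction t)
  case (Suc t)
  show ?case
  proof (cases "s = Suc t")
    case False
    then have "subdist w (r t) < m" using Suc by simp
    moreover have "\<not> m dvd subdist w (r (Suc t))"
      using Suc.prems(2)[of "Suc t"] Suc.prems(1)
      unfolding dvd_answer_iff dvd_subdist_iff[OF r_in assms(1), symmetric] by simp
    then have "subdist w (r (Suc t)) \<noteq> m" by auto
    ultimately show ?thesis using subdist_move(1)[OF play assms(1), of t 1] by simp
  qed (use assms in simp)
qed (use assms in simp)

end

text \<open>
  If the strategy for \<open>G\<close> locates the shadow at its turn \<open>j\<close>, the robber is located at the
  checkpoint with index \<open>j\<close>: another robber with the same answers has a checkpoint
  at the same time, and its shadow has given the same answers up to turn \<open>j\<close>.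
\<close>

lemma located_by_recurring_checkpoints:
  assumes run: "run r a" and recurring: "\<And>N. \<exists>t\<ge>N. checkpoint a t"
  shows "\<exists>T. \<forall>r' a'. run r' a' \<longrightarrow> (\<forall>i\<le>T. a' i = a i) \<longrightarrow> r' T = r T"
proof -
  obtain \<rho> where \<rho>: "robber_play G \<rho>" "\<And>t. answers G \<sigma> \<rho> (length (hist a t)) = hist a t"
    "\<And>t. checkpoint a t \<Longrightarrow> r t = Branch (\<rho> (length (hist a t)))"
    using shadow[OF run] by metis
  obtain j where j: "located_at G \<sigma> \<rho> j" using winning[OF \<rho>(1)] by blast
  obtain T where T: "checkpoint a T" "length (hist a T) = j" using checkpoint_of_each_length[OF recurring] by blast
  have "r' T = r T" if run': "run r' a'" and same: "\<forall>i\<le>T. a' i = a i" for r' a'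
  proof -
    obtain \<rho>' where \<rho>': "robber_play G \<rho>'"
      "\<And>t. answers G \<sigma> \<rho>' (length (hist a' t)) = hist a' t"
      "\<And>t. checkpoint a' t \<Longrightarrow> r' t = Branch (\<rho>' (length (hist a' t)))"
      using shadow[OF run'] by metis
    have ev: "checkpoint a' T" using T same checkpoint_causal[of T a' a] by blast
    have hist: "hist a' (Suc T) = hist a (Suc T)" "hist a' T = hist a T"
      using same by (auto intro!: causal(2) simp del: hist.simps)
    have len: "length (hist a (Suc T)) = Suc j" using T by simp
    have "answers G \<sigma> \<rho>' (Suc j) = answers G \<sigma> \<rho> (Suc j)"
      using \<rho>(2)[of "Suc T"] \<rho>'(2)[of "Suc T"] unfolding hist len by simp
    then have "\<rho>' j = \<rho> j" using j \<rho>'(1) unfolding located_at_def by blast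
    then show ?thesis using \<rho>(3)[OF T(1)] \<rho>'(3)[OF ev] T hist by simp
  qed
  then show ?thesis by blast
qed

lemma eventually_probed:
  assumes "v \<in> pverts G"
  obtains t where "N \<le> t" "\<And>a. target a t = v"
proof -
  obtain n where n: "n \<ge> N" "sweep n = v" using sweep_recurrent[OF assms] by blast
  define t where "t = k + Suc k * n"
  have "N \<le> t" using n by (simp add: t_def)
  moreover have "t mod Suc k = k" "t div Suc k = n" by (simp_all add: t_def del: mult_Suc)
  then have "target a t = v" for a using n by (simp add: target_def)
  ultimately show thesis using that by blast
qed

text \<open>
  Without checkpoints from \<open>N\<close> on, the robber meets no branch vertex from \<open>N + k\<close> on. Let \<open>u\<close> and
  \<open>v\<close> be the ends of his edge. Any robber with the same answers has been inside one edge ever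
  since; the probe of \<open>u\<close> in turn \<open>t\<close> shows that it ends at \<open>u\<close>, the later probe of
  \<open>v\<close> in turn \<open>T\<close> that it ends at \<open>v\<close> and where on it he is.
\<close>

lemma located_on_edge:
  assumes run: "run r a" and no_checkpoint: "\<And>t. N \<le> t \<Longrightarrow> \<not> checkpoint a t"
  shows "\<exists>T. \<forall>r' a'. run r' a' \<longrightarrow> (\<forall>i\<le>T. a' i = a i) \<longrightarrow> r' T = r T"
proof -
  have "i \<le> gap a (N + i)" for i
    by (induction i) (use no_checkpoint in \<open>auto simp: gap_Suc simp del: gap.simps\<close>)
  then have inner: "\<not> m dvd a t" if "N + k \<le> t" for t
    using that no_checkpoint[of t] le_add_diff_inverse[of N t] unfolding checkpoint_def
    by (metis add_leD1 add_le_cancel_left order_trans)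
  let ?s = "N + k"
  have "\<nexists>u. r ?s = Branch u"
    using inner[of ?s] dvd_answer_iff[OF run, of ?s] r_in[OF run, of ?s] by auto
  then obtain u v where uv: "u \<in> pverts G" "v \<in> pverts G" "u \<noteq> v"
    and near: "subdist u (r ?s) < m" "subdist v (r ?s) < m"
    using inner_ends[OF r_in[OF run]] by blast
  obtain t where t: "?s \<le> t" "\<And>a. target a t = u" using eventually_probed uv by metis
  obtain T where T: "t \<le> T" "\<And>a. target a T = v" using eventually_probed uv by metis
  have *: "r' T = subdiv_point m v u (a T)"
    if run': "run r' a'" and same: "\<forall>i\<le>T. a' i = a i" for r' a'
  proof -
    have inner': "\<not> m dvd a' i" if "?s \<le> i" "i \<le> T" for i
      using inner that same by auto
    have "subdist u (r' t) = subdist u (r t)"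
      using answer[OF run', of t] answer[OF run, of t] t T same by simp
    moreover have "subdist u (r t) < m"
      by (rule remains_near[OF run uv(1) t(1) near(1)]) (use inner in simp)
    ultimately have "subdist u (r' T) < m"
      by (intro remains_near[OF run' uv(1) T(1)]) (use inner' t in simp_all)
    moreover have aT: "subdist v (r' T) = a T" "subdist v (r T) = a T"
      using answer[OF run', of T] answer[OF run, of T] T same by simp_all
    moreover have "subdist v (r T) < m"
      by (rule remains_near[OF run uv(2) _ near(2)]) (use inner t T in simp_all)
    moreover have "\<nexists>u. r' T = Branch u"
      using inner'[of T] t T dvd_answer_iff[OF run', of T] r_in[OF run', of T] by auto
    ultimately show ?thesis
      using near_two_ends[OF r_in[OF run'] _ uv, of T] by simp
  qed
  moreover have "r T = subdiv_point m v u (a T)" using *[OF run] by simp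
  ultimately show ?thesis by (intro exI[of _ T]) simp
qed

lemma eventually_located:
  assumes "run r a"
  shows "\<exists>T. \<forall>r' a'. run r' a' \<longrightarrow> (\<forall>i\<le>T. a' i = a i) \<longrightarrow> r' T = r T"
proof (cases "\<forall>N. \<exists>t\<ge>N. checkpoint a t")
  case True
  then show ?thesis using located_by_recurring_checkpoints[OF assms] by blast
next
  case False
  then obtain N where "\<And>t. N \<le> t \<Longrightarrow> \<not> checkpoint a t" by blast
  then show ?thesis using located_on_edge[OF assms] by blast
qed

text \<open>The simulation reads natural numbers, whereas the game delivers distances as extended reals.\<close>

lemma locatable_subdivision: "locatable H"
proof -
  let ?nat = "\<lambda>a i. nat \<lfloor>real_of_ereal (a i)\<rfloor>"
  let ?p = "\<lambda>a t. Branch (target (?nat a) t)"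
  have runI: "run r (?nat a) \<and> a = (\<lambda>i. ereal (real (?nat a i)))" if "probe_run H ?p r a" for r a
  proof -
    have r: "robber_play H r" "\<And>t. gdist H (r t) (?p a t) = a t"
      using that by (auto simp: probe_run_def)
    then have "a t = ereal (real (subdist (target (?nat a) t) (r t)))" for t
      using gdist_eq_subdist[of "r t" "target (?nat a) t"] target_in by (simp add: robber_play_def)
    then have "?nat a t = subdist (target (?nat a) t) (r t) \<and> a t = ereal (real (?nat a t))" for t
      by (metis floor_of_nat nat_int real_of_ereal.simps(1))
    then have "\<forall>t. ?nat a t = subdist (target (?nat a) t) (r t)"
      and "a = (\<lambda>i. ereal (real (?nat a i)))" by blast+
    with r(1) show ?thesis unfolding run_def by blast
  qed
  show ?thesis
  proof (rule locatable_by_causal_probing[of ?p])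
    fix a b :: "nat \<Rightarrow> ereal" and t
    assume "\<And>i. i < t \<Longrightarrow> a i = b i"
    then have "hist (?nat a) t = hist (?nat b) t" by (intro causal(2)) simp
    then show "?p a t = ?p b t" by (simp add: target_def)
  next
    show "?p a t \<in> pverts H" for a t using target_in by simp
  next
    fix r a assume "probe_run H ?p r a"
    then have "run r (?nat a)" using runI by blast
    then obtain T where T: "\<And>r' a'. run r' a' \<Longrightarrow> (\<forall>i\<le>T. a' i = ?nat a i) \<Longrightarrow> r' T = r T"
      using eventually_located by blast
    have "r' T = r T" if "probe_run H ?p r' a'" "\<forall>i\<le>T. a' i = a i" for r' a'
      by (rule T[of r' "?nat a'"]) (use that runI[of r' a'] in simp_all)
    then show "\<exists>T. \<forall>r' a'. probe_run H ?p r' a' \<longrightarrow> (\<forall>i\<le>T. a' i = a i) \<longrightarrow> r' T = r T"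
      by blast
  qed
qed

end

section \<open>Subdivisions of locatable graphs\<close>

theorem theorem2:
  fixes G :: "'a pair_pre_digraph" and k m :: nat
  assumes "pair_bidirected_digraph G"
    and "connected (with_proj G)"
    and "k > 0"
    and "k_locatable k G"
    and "m \<ge> 2 * k + 2"
  shows "locatable (subdivide_edges m G)"
proof -
  interpret G: connected_simple_graph G
    using assms by (simp add: connected_simple_graph_def connected_simple_graph_axioms_def)
  have nonempty: "pverts G \<noteq> {}"
    using assms(2) by (auto simp: connected_def strongly_connected_def)
  obtain e :: "nat \<Rightarrow> 'a" where e: "range e \<subseteq> pverts G" "\<And>v N. v \<in> pverts G \<Longrightarrow> \<exists>n\<ge>N. e n = v"
    by (rule recurrent_enumeration[OF G.countable_if_locatable[OF assms(4)] nonempty]) (rule that)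
  obtain \<sigma> where \<sigma>: "probe_strategy k G \<sigma>" "\<And>r. robber_play G r \<Longrightarrow> \<exists>t. located_at G \<sigma> r t"
    using assms(4) unfolding k_locatable_def by blast
  interpret simulated_strategy G m k \<sigma> e
    by unfold_locales (use assms \<sigma> e in auto)
  show ?thesis by (rule locatable_subdivision)
qed

end
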